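(* Let $g = -\frac{dT^2}{(V+cT)^2} + (V+cT)^2\,|d\mathbf{x}|^2$ be the Kastor-Traschen metric, where $V=V(\mathbf{x})$ is a harmonic function of the spatial coordinates $\mathbf{x}=(x^1,x^2,x^3)$ and $c$ is a constant. Let $(T(s),\mathbf{x}(s))$ be a null geodesic of $g$, with $s$ the Euclidean arc-length parameter of the spatial part, $|\dot{\mathbf{x}}|=1$. Then, for $i=1,2,3$, $$\dddot{x}^i=-|\ddot{\mathbf{x}}|^2\dot{x}^i-\frac{3\,(\ddot{\mathbf{x}}\cdot\nabla V)}{2\left(|\nabla V|^2-(\dot{\mathbf{x}}\cdot\nabla V)^2\right)}(\dot{\mathbf{x}}\cdot\nabla V)\,\ddot{x}^i-2c\left(\partial_iV-(\dot{\mathbf{x}}\cdot\nabla V)\dot{x}^i\right)+\frac{2}{V+cT}\left(\sum_m\partial_i\partial_mV\,\dot{x}^m-\sum_{k,l}\partial_k\partial_lV\,\dot{x}^k\dot{x}^l\,\dot{x}^i\right).$$ Moreover the factor $\frac{2}{V+cT}$ can be eliminated using the identity $\ddot{\mathbf{x}}\cdot\nabla V=\frac{2}{V+cT}\left(|\nabla V|^2-(\dot{\mathbf{x}}\cdot\nabla V)^2\right)$, which holds along the null geodesic, so that the projection $\mathbf{x}(s)$ of the null geodesic to the space of orbits of $\partial/\partial T$ satisfies a system of third-order ordinary differential equations depending only on the spatial coordinates.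
   Context: The Kastor-Traschen metric is a solution of the Einstein-Maxwell equations with positive cosmological constant $\Lambda$, with $c=\pm\sqrt{\Lambda/3}$; $|d\mathbf{x}|^2$ is the flat Euclidean metric on $\mathbb{R}^3$ in Cartesian coordinates. Dots denote $d/ds$; dot products, norms and $\nabla$ are Euclidean on $\mathbb{R}^3$, and $\partial_i=\partial/\partial x^i$. Null geodesics are regarded as unparametrised curves, so they may be parametrised by the Euclidean arc length of their spatial part.
   Formalization: The arc length s is oriented so that T increases (dT/ds > 0); with the opposite orientation the term with 2c changes sign and the printed formula fails for nonzero c. The T-free system is asserted where |∇V|² − (ẋ·∇V)² ≠ 0. *)

theory Defs
  imports "HOL-Analysis.Analysis"
begin

definition partial :: "'n::finite \<Rightarrow> (real^'n \<Rightarrow> real) \<Rightarrow> real^'n \<Rightarrow> real" where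
  "partial i f p = frechet_derivative f (at p) (axis i 1)"

definition grad :: "(real^'n::finite \<Rightarrow> real) \<Rightarrow> real^'n \<Rightarrow> real^'n" where
  "grad f p = (\<chi> i. partial i f p)"

definition C2_on :: "(real^'n::finite) set \<Rightarrow> (real^'n \<Rightarrow> real) \<Rightarrow> bool" where
  "C2_on S f \<longleftrightarrow>
     (\<forall>p\<in>S. f differentiable (at p)) \<and>
     (\<forall>i. \<forall>p\<in>S. partial i f differentiable (at p)) \<and>
     (\<forall>i j. continuous_on S (partial i (partial j f)))"

definition harmonic_on :: "(real^'n::finite) set \<Rightarrow> (real^'n \<Rightarrow> real) \<Rightarrow> bool" where
  "harmonic_on S f \<longleftrightarrow>
     open S \<and> C2_on S f \<and> (\<forall>p\<in>S. (\<Sum>i\<in>UNIV. partial i (partial i f) p) = 0)"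

definition dot :: "(real \<Rightarrow> 'a::real_normed_vector) \<Rightarrow> real \<Rightarrow> 'a" where
  "dot f s = vector_derivative f (at s)"

definition twice_differentiable_on :: "real set \<Rightarrow> (real \<Rightarrow> 'a::real_normed_vector) \<Rightarrow> bool" where
  "twice_differentiable_on I f \<longleftrightarrow>
     (\<forall>s\<in>I. f differentiable (at s)) \<and> (\<forall>s\<in>I. dot f differentiable (at s))"

text \<open>A metric on a coordinate domain is given by its component matrix \<open>g p $ a $ b\<close>
  at each point \<open>p\<close>; \<open>christoffel g a b d p\<close> carries the upper index first.\<close>

definition christoffel ::
  "(real^'n::finite \<Rightarrow> real^'n^'n) \<Rightarrow> 'n \<Rightarrow> 'n \<Rightarrow> 'n \<Rightarrow> real^'n \<Rightarrow> real" where
  "christoffel g a b d p =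
     (1/2) * (\<Sum>e\<in>UNIV. matrix_inv (g p) $ a $ e *
       (partial b (\<lambda>q. g q $ e $ d) p + partial d (\<lambda>q. g q $ e $ b) p
        - partial e (\<lambda>q. g q $ b $ d) p))"

definition affine_geodesic_on ::
  "(real^'n::finite \<Rightarrow> real^'n^'n) \<Rightarrow> (real^'n) set \<Rightarrow> real set \<Rightarrow> (real \<Rightarrow> real^'n) \<Rightarrow> bool" where
  "affine_geodesic_on g M J \<sigma> \<longleftrightarrow>
     twice_differentiable_on J \<sigma> \<and>
     (\<forall>t\<in>J. \<sigma> t \<in> M \<and>
       (\<forall>a. dot (dot \<sigma>) t $ a
          + (\<Sum>b\<in>UNIV. \<Sum>d\<in>UNIV. christoffel g a b d (\<sigma> t) * dot \<sigma> t $ b * dot \<sigma> t $ d) = 0))"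

definition null_vector :: "real^'n::finite^'n \<Rightarrow> real^'n \<Rightarrow> bool" where
  "null_vector G v \<longleftrightarrow> v \<noteq> 0 \<and> (\<Sum>a\<in>UNIV. \<Sum>b\<in>UNIV. G $ a $ b * v $ a * v $ b) = 0"

text \<open>Null geodesics as unparametrised curves: \<open>\<gamma>\<close> is an arbitrary regular
  reparametrisation of an affinely parametrised null geodesic.\<close>

definition null_geodesic_on ::
  "(real^'n::finite \<Rightarrow> real^'n^'n) \<Rightarrow> (real^'n) set \<Rightarrow> real set \<Rightarrow> (real \<Rightarrow> real^'n) \<Rightarrow> bool" where
  "null_geodesic_on g M I \<gamma> \<longleftrightarrow>
     (\<exists>J \<sigma> \<phi>. open J \<and> is_interval J \<and>
        affine_geodesic_on g M J \<sigma> \<and> (\<forall>t\<in>J. null_vector (g (\<sigma> t)) (dot \<sigma> t)) \<and>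
        twice_differentiable_on I \<phi> \<and> (\<forall>s\<in>I. dot \<phi> s \<noteq> 0) \<and> \<phi> ` I = J \<and>
        (\<forall>s\<in>I. \<gamma> s = \<sigma> (\<phi> s)))"

text \<open>Space-time coordinates are indexed by \<open>3 option\<close>: \<open>None\<close> is the time
  coordinate \<open>T\<close> and \<open>Some i\<close> the spatial coordinate \<open>x\<^sup>i\<close>.\<close>

definition event :: "real \<Rightarrow> real^3 \<Rightarrow> real^(3 option)" where
  "event T x = (\<chi> a. case a of None \<Rightarrow> T | Some i \<Rightarrow> x $ i)"

definition space :: "real^(3 option) \<Rightarrow> real^3" where
  "space p = (\<chi> i. p $ Some i)"

definition kt_factor :: "(real^3 \<Rightarrow> real) \<Rightarrow> real \<Rightarrow> real^(3 option) \<Rightarrow> real" where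
  "kt_factor V c p = V (space p) + c * p $ None"

definition kt_metric :: "(real^3 \<Rightarrow> real) \<Rightarrow> real \<Rightarrow> real^(3 option) \<Rightarrow> real^(3 option)^(3 option)" where
  "kt_metric V c p = (\<chi> a b. if a \<noteq> b then 0 else
     (case a of None \<Rightarrow> - 1 / (kt_factor V c p)\<^sup>2 | Some i \<Rightarrow> (kt_factor V c p)\<^sup>2))"

definition kt_domain :: "(real^3) set \<Rightarrow> (real^3 \<Rightarrow> real) \<Rightarrow> real \<Rightarrow> (real^(3 option)) set" where
  "kt_domain \<Omega> V c = {p. space p \<in> \<Omega> \<and> kt_factor V c p \<noteq> 0}"

text \<open>Right-hand side of the third-order system for the projected curve as a function of
  position \<open>y\<close>, velocity \<open>v\<close> and acceleration \<open>a\<close>. The factor \<open>k\<close> is what replaces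
  \<open>2 / (V + c T)\<close>. The sign of the \<open>2 * c\<close> term belongs to the orientation of the arc length
  for which \<open>T\<close> increases: nullity only gives \<open>dT/ds = \<plusminus> (V + c T)\<^sup>2\<close>, and the other
  orientation flips this term relative to the rest.\<close>

definition kt_projected_rhs ::
  "(real^3 \<Rightarrow> real) \<Rightarrow> real \<Rightarrow> real^3 \<Rightarrow> real^3 \<Rightarrow> real^3 \<Rightarrow> real^3" where
  "kt_projected_rhs V c y v a =
     (let N = grad V y;
          W = (norm N)\<^sup>2 - (v \<bullet> N)\<^sup>2;
          k = (a \<bullet> N) / W
      in \<chi> i. - (norm a)\<^sup>2 * v $ i
           - 3 * (a \<bullet> N) / (2 * W) * (v \<bullet> N) * a $ i
           - 2 * c * (partial i V y - (v \<bullet> N) * v $ i)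
           + k * ((\<Sum>m\<in>UNIV. partial i (partial m V) y * v $ m)
                  - (\<Sum>j\<in>UNIV. \<Sum>l\<in>UNIV. partial j (partial l V) y * v $ j * v $ l * v $ i)))"

end

(*
  Write U = V + c T. Along an affinely parametrised null geodesic with velocity v, the spatial
  acceleration is 2/U (|v|^2 grad V - dU(v) v): nullity turns the (dT)^2 term into a multiple of
  |v|^2. A change of parameter only adds a multiple of the velocity, and for arc length the
  total multiple is fixed by x'' being orthogonal to x'. Hence
  x'' = 2/U (grad V - (x' . grad V) x'), while nullity gives T' = U^2. Differentiating once
  more, U' = x' . grad V + c U^2 produces the c-term, and 1/U is eliminated
  by x'' . grad V = 2/U (|grad V|^2 - (x' . grad V)^2); where this bracket vanishes, x'' = 0.
*)

theory Submission
  imports Defs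
begin

section \<open>Gradients, the chain rule along curves, and symmetry of second partial
  derivatives\<close>

lemma has_derivative_grad:
  assumes "f differentiable (at p)"
  shows "(f has_derivative (\<lambda>h. grad f p \<bullet> h)) (at p)"
proof -
  let ?D = "frechet_derivative f (at p)"
  have D: "(f has_derivative ?D) (at p)"
    using assms by (simp add: frechet_derivative_works)
  then interpret linear ?D
    by (rule has_derivative_linear)
  have "?D h = grad f p \<bullet> h" for h
  proof -
    have "?D h = ?D (\<Sum>i\<in>UNIV. h $ i *\<^sub>R axis i 1)"
      by (simp add: basis_expansion flip: scalar_mult_eq_scaleR)
    also have "\<dots> = grad f p \<bullet> h"
      by (simp add: sum scale grad_def partial_def inner_vec_def mult.commute)
    finally show ?thesis .
  qed
  then show ?thesis
    using D by presburger
qed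

lemma partial_eq:
  assumes "(f has_derivative D) (at p)"
  shows "partial i f p = D (axis i 1)"
  using frechet_derivative_at[OF assms] by (simp add: partial_def)

lemma DERIV_along_curve:
  assumes "(\<gamma> has_vector_derivative v) (at s)" and "f differentiable (at (\<gamma> s))"
  shows "((\<lambda>r. f (\<gamma> r)) has_real_derivative (grad f (\<gamma> s) \<bullet> v)) (at s)"
proof -
  have "((\<lambda>r. f (\<gamma> r)) has_derivative (\<lambda>h. grad f (\<gamma> s) \<bullet> (h *\<^sub>R v))) (at s)"
    using has_derivative_compose[OF assms(1)[unfolded has_vector_derivative_def]
        has_derivative_grad[OF assms(2)]] .
  then show ?thesis
    by (simp add: has_field_derivative_def mult_commute_abs)
qed

lemma DERIV_along_axis:
  assumes "f differentiable (at (q + t *\<^sub>R axis i 1))"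
  shows "((\<lambda>r. f (q + r *\<^sub>R axis i 1)) has_real_derivative
           partial i f (q + t *\<^sub>R axis i 1)) (at t)"
proof -
  have "((\<lambda>r. q + r *\<^sub>R axis i 1) has_vector_derivative axis i 1) (at t)"
    by (auto intro!: derivative_eq_intros)
  from DERIV_along_curve[OF this assms] show ?thesis
    by (simp add: inner_axis grad_def)
qed

text \<open>The left-hand side is symmetric in \<open>i\<close> and \<open>j\<close>, so letting \<open>h\<close> tend to \<open>0\<close> gives Schwarz's theorem.\<close>

lemma mixed_difference:
  assumes "\<And>q. q \<in> cball p (2 * h) \<Longrightarrow> f differentiable (at q)"
    and "\<And>q. q \<in> cball p (2 * h) \<Longrightarrow> partial i f differentiable (at q)"
    and "h > 0"
  shows "\<exists>q\<in>cball p (2 * h).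
    f (p + h *\<^sub>R axis i 1 + h *\<^sub>R axis j 1) - f (p + h *\<^sub>R axis i 1) - f (p + h *\<^sub>R axis j 1) + f p
      = h\<^sup>2 * partial j (partial i f) q"
proof -
  \<comment> \<open>Two axis steps of length at most \<open>h\<close> move a point by at most
    \<open>2 * h\<close>; this fixes the radius of the ball.\<close>
  have mem: "p + u *\<^sub>R axis i 1 + w *\<^sub>R axis j 1 \<in> cball p (2 * h)"
    if "0 \<le> u" "u \<le> h" "0 \<le> w" "w \<le> h" for u w
  proof -
    have "norm (u *\<^sub>R axis i 1 + w *\<^sub>R axis j (1::real)) \<le> u + w"
      by (rule norm_triangle_le) (use that in simp)
    also have "\<dots> \<le> 2 * h"
      using that by simp
    finally show ?thesis
      by (simp add: dist_norm algebra_simps norm_minus_commute)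
  qed
  \<comment> \<open>The mixed difference is \<open>?g h - ?g 0\<close>, where \<open>?g\<close> is
    already a difference in direction \<open>j\<close>. The mean value theorem is applied first
    along \<open>i\<close>, then along \<open>j\<close> to the resulting difference of
    \<open>partial i f\<close>.\<close>
  let ?g = "\<lambda>u. f ((p + h *\<^sub>R axis j 1) + u *\<^sub>R axis i 1) - f (p + u *\<^sub>R axis i 1)"
  have "(?g has_real_derivative
      partial i f ((p + h *\<^sub>R axis j 1) + u *\<^sub>R axis i 1) - partial i f (p + u *\<^sub>R axis i 1)) (at u)"
    if "0 \<le> u" "u \<le> h" for u
    using mem[of u h] mem[of u 0] that \<open>h > 0\<close>
    by (intro DERIV_diff DERIV_along_axis assms(1)) (auto simp: ac_simps)
  from MVT2[OF \<open>h > 0\<close>, of ?g, OF this] obtain u where u: "0 < u" "u < h" and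
    gu: "?g h - ?g 0
      = h * (partial i f ((p + u *\<^sub>R axis i 1) + h *\<^sub>R axis j 1) - partial i f (p + u *\<^sub>R axis i 1))"
    by (auto simp: ac_simps)
  let ?k = "\<lambda>w. partial i f ((p + u *\<^sub>R axis i 1) + w *\<^sub>R axis j 1)"
  have "(?k has_real_derivative partial j (partial i f) ((p + u *\<^sub>R axis i 1) + w *\<^sub>R axis j 1)) (at w)"
    if "0 \<le> w" "w \<le> h" for w
    using mem[of u w] that u by (intro DERIV_along_axis assms(2)) auto
  from MVT2[OF \<open>h > 0\<close>, of ?k, OF this] obtain w where w: "0 < w" "w < h" and
    kw: "?k h - ?k 0 = h * partial j (partial i f) (p + u *\<^sub>R axis i 1 + w *\<^sub>R axis j 1)"
    by auto
  have "?g h - ?g 0 = h\<^sup>2 * partial j (partial i f) (p + u *\<^sub>R axis i 1 + w *\<^sub>R axis j 1)"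
    using gu kw by (simp add: power2_eq_square)
  then show ?thesis
    using mem[of u w] u w by (intro bexI) (auto simp: algebra_simps)
qed

text \<open>Both orders of differentiation are limits of the same mixed difference divided by the
  squared step. Differentiating \<open>partial i V\<close> along a curve produces the second
  partials in the order opposite to that of the theorem, hence the need for symmetry.\<close>

lemma C2_on_partial_commute:
  assumes "C2_on S f" "open S" "p \<in> S"
  shows "partial i (partial j f) p = partial j (partial i f) p"
proof -
  obtain e where e: "e > 0" "cball p e \<subseteq> S"
    using assms(2,3) open_contains_cball by blast
  \<comment> \<open>The factor 1/2 keeps the balls of radius \<open>2 * h n\<close> inside
    \<open>cball p e\<close>, hence inside \<open>S\<close>.\<close>
  define h where "h n = e * inverse (real (Suc n)) / 2" for n
  have h: "h n > 0" "cball p (2 * h n) \<subseteq> S" for n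
  proof -
    show "h n > 0"
      using e by (simp add: h_def)
    have "2 * h n \<le> e"
      using e by (simp add: h_def field_simps)
    then show "cball p (2 * h n) \<subseteq> S"
      using e(2) by (meson order_trans subset_cball)
  qed
  have h0: "(\<lambda>n. 2 * h n) \<longlonglongrightarrow> 0"
    using tendsto_mult_left[OF LIMSEQ_inverse_real_of_nat, of e] by (simp add: h_def)
  \<comment> \<open>Intermediate points are squeezed to \<open>p\<close> by the shrinking radii, and
    the second partials are continuous on \<open>S\<close>.\<close>
  have lim: "(\<lambda>n. partial a (partial b f) (q n)) \<longlonglongrightarrow> partial a (partial b f) p"
    if "\<forall>n. q n \<in> cball p (2 * h n)" for a b q
  proof -
    have "dist (q n) p \<le> dist (2 * h n) 0" for n
      using that h(1)[of n] by (simp add: dist_commute)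
    then have "q \<longlonglongrightarrow> p"
      by (intro metric_tendsto_imp_tendsto[OF h0] always_eventually allI)
    moreover have "q n \<in> S" for n
      using that h(2) by blast
    moreover have "continuous_on S (partial a (partial b f))"
      using assms(1) by (simp add: C2_on_def)
    ultimately show ?thesis
      using assms(3) by (auto intro: continuous_on_tendsto_compose)
  qed
  have diff: "f differentiable (at q)" "partial a f differentiable (at q)"
    if "q \<in> cball p (2 * h n)" for n q a
  proof -
    have "q \<in> S"
      using h(2) that by blast
    then show "f differentiable (at q)" "partial a f differentiable (at q)"
      using assms(1) by (simp_all add: C2_on_def)
  qed
  let ?d = "\<lambda>n a b. f (p + h n *\<^sub>R axis a 1 + h n *\<^sub>R axis b 1) - f (p + h n *\<^sub>R axis a 1)
     - f (p + h n *\<^sub>R axis b 1) + f p"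
  have mixed: "\<exists>q. \<forall>n. q n \<in> cball p (2 * h n) \<and> ?d n a b = (h n)\<^sup>2 * partial b (partial a f) (q n)"
    for a b
  proof (rule choice, rule allI)
    fix n
    show "\<exists>q. q \<in> cball p (2 * h n) \<and> ?d n a b = (h n)\<^sup>2 * partial b (partial a f) q"
      using mixed_difference[OF diff(1)[where n = n] diff(2)[where n = n and a = a] h(1), where j = b] by blast
  qed
  obtain q where q: "\<forall>n. q n \<in> cball p (2 * h n)"
      "\<And>n. ?d n j i = (h n)\<^sup>2 * partial i (partial j f) (q n)"
    using mixed[of j i] by blast
  obtain q' where q': "\<forall>n. q' n \<in> cball p (2 * h n)"
      "\<And>n. ?d n i j = (h n)\<^sup>2 * partial j (partial i f) (q' n)"
    using mixed[of i j] by blast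
  have "partial i (partial j f) (q n) = partial j (partial i f) (q' n)" for n
  proof -
    \<comment> \<open>Exchanging the two displacements only reorders summands.\<close>
    have "?d n i j = ?d n j i"
      by (simp add: add_ac)
    then have "(h n)\<^sup>2 * partial i (partial j f) (q n) = (h n)\<^sup>2 * partial j (partial i f) (q' n)"
      using q(2)[of n] q'(2)[of n] by presburger
    then show ?thesis
      using h(1)[of n] by simp
  qed
  then show ?thesis
    using LIMSEQ_unique[OF lim[OF q(1), of i j]] lim[OF q'(1), of j i] by simp
qed

section \<open>Inverses of diagonal matrices\<close>

lemma matrix_inv_unique:
  fixes A :: "real^'n::finite^'n"
  assumes "A ** B = mat 1" "B ** A = mat 1"
  shows "matrix_inv A = B"
proof -
  \<comment> \<open>\<open>matrix_inv\<close> is a Hilbert choice: the witness \<open>B\<close>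
    shows that the chosen matrix is a two-sided inverse, and such inverses are unique.\<close>
  have "A ** matrix_inv A = mat 1 \<and> matrix_inv A ** A = mat 1"
    unfolding matrix_inv_def by (rule someI[where x = B]) (use assms in simp)
  then show ?thesis
    using assms(1) by (metis matrix_mul_assoc matrix_mul_lid matrix_mul_rid)
qed

lemma matrix_inv_diagonal:
  fixes d :: "'n::finite \<Rightarrow> real"
  assumes "\<And>a. d a \<noteq> 0"
  shows "matrix_inv (\<chi> a b. if a \<noteq> b then 0 else d a) = (\<chi> a b. if a \<noteq> b then 0 else inverse (d a))"
proof (rule matrix_inv_unique)
  have *: "(\<Sum>k\<in>UNIV. (if a \<noteq> k then 0 else x) * (if k \<noteq> b then 0 else g k))
      = (if a = b then x * g b else 0)" for a b :: 'n and x and g :: "'n \<Rightarrow> real"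
  proof -
    have "(\<Sum>k\<in>UNIV. (if a \<noteq> k then 0 else x) * (if k \<noteq> b then 0 else g k))
        = (\<Sum>k\<in>UNIV. if a = k then (if a = b then x * g b else 0) else 0)"
      by (rule sum.cong) auto
    then show ?thesis
      by simp
  qed
  show "(\<chi> a b. if a \<noteq> b then 0 else d a) ** (\<chi> a b. if a \<noteq> b then 0 else inverse (d a)) = mat 1"
    "(\<chi> a b. if a \<noteq> b then 0 else inverse (d a)) ** (\<chi> a b. if a \<noteq> b then 0 else d a) = mat 1"
    unfolding matrix_matrix_mult_def vec_lambda_beta *
    using assms by (auto simp: mat_def vec_eq_iff)
qed

section \<open>Time and space parts of space-time vectors, and the differential of U = V + c
  T\<close>

lemma sum_UNIV_option:
  fixes f :: "'a::finite option \<Rightarrow> 'b::comm_monoid_add"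
  shows "(\<Sum>a\<in>UNIV. f a) = f None + (\<Sum>i\<in>UNIV. f (Some i))"
  by (simp add: UNIV_option_conv sum.reindex)

lemma space_event [simp]: "space (event t y) = y"
  by (simp add: space_def event_def)

lemma event_None [simp]: "event t y $ None = t"
  by (simp add: event_def)

lemma space_nth [simp]: "space p $ i = p $ Some i"
  by (simp add: space_def)

lemma bounded_linear_space: "bounded_linear space"
  by (rule linear_conv_bounded_linear[THEN iffD1], rule linearI) (simp_all add: vec_eq_iff)

lemmas space_linear =
  linear_add[OF bounded_linear.linear[OF bounded_linear_space]]
  linear_scale[OF bounded_linear.linear[OF bounded_linear_space]]

lemma norm_space: "(norm (space v))\<^sup>2 = (\<Sum>i\<in>UNIV. (v $ Some i)\<^sup>2)"
  by (simp add: power2_norm_eq_inner) (simp add: inner_vec_def power2_eq_square)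

text \<open>The differential dU of U = V + c T at \<open>p\<close>, applied to
  \<open>h\<close>.\<close>

definition kt_factor_deriv :: "(real^3 \<Rightarrow> real) \<Rightarrow> real \<Rightarrow> real^(3 option) \<Rightarrow> real^(3 option) \<Rightarrow> real" where
  "kt_factor_deriv V c p h = grad V (space p) \<bullet> space h + c * h $ None"

lemma kt_factor_has_derivative:
  assumes "V differentiable (at (space p))"
  shows "(kt_factor V c has_derivative kt_factor_deriv V c p) (at p)"
proof -
  have "((\<lambda>q. V (space q)) has_derivative (\<lambda>h. grad V (space p) \<bullet> space h)) (at p)"
    using has_derivative_compose[OF bounded_linear_imp_has_derivative[OF bounded_linear_space]
        has_derivative_grad[OF assms]] .
  then show ?thesis
    unfolding kt_factor_def[abs_def] kt_factor_deriv_def[abs_def]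
    by (auto intro!: derivative_eq_intros bounded_linear_imp_has_derivative bounded_linear_vec_nth)
qed

text \<open>Linearity of dU: the Christoffel symbols contain dU only on basis vectors, and
  contraction with a velocity has to return dU of that velocity.\<close>

lemma kt_factor_deriv_expand:
  "(\<Sum>a\<in>UNIV. kt_factor_deriv V c p (axis a 1) * v $ a) = kt_factor_deriv V c p v"
proof -
  have "space (axis None 1) = 0" "space (axis (Some i) 1) = axis i 1" for i
    by (simp_all add: vec_eq_iff axis_def)
  then show ?thesis
    by (simp add: kt_factor_deriv_def sum_UNIV_option inner_axis)
       (simp add: inner_vec_def axis_def)
qed

lemma kt_factor_deriv_axis_Some [simp]:
  "kt_factor_deriv V c p (axis (Some i) 1) = partial i V (space p)"
proof -
  have "space (axis (Some i) 1) = axis i 1"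
    by (simp add: vec_eq_iff axis_def)
  then show ?thesis
    by (simp add: kt_factor_deriv_def inner_axis grad_def) (simp add: axis_def)
qed

section \<open>Christoffel symbols of the metric with spatial upper index\<close>

lemma partial_kt_metric:
  assumes "V differentiable (at (space p))" and "kt_factor V c p \<noteq> 0"
  shows "partial a (\<lambda>q. kt_metric V c q $ b $ d) p =
    (if b \<noteq> d then 0 else kt_factor_deriv V c p (axis a 1) *
      (case b of None \<Rightarrow> 2 / (kt_factor V c p)^3 | Some _ \<Rightarrow> 2 * kt_factor V c p))"
proof -
  note U = kt_factor_has_derivative[OF assms(1), of c]
  \<comment> \<open>Each diagonal entry is F(U) with F(u) = -1/u^2 or F(u) = u^2, so its partials
    are F'(U) times those of U.\<close>
  have chain: "partial a (\<lambda>q. F (kt_factor V c q)) p = kt_factor_deriv V c p (axis a 1) * F'"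
    if "(F has_real_derivative F') (at (kt_factor V c p))" for F F'
    using partial_eq[OF has_derivative_compose[OF U that[unfolded has_field_derivative_def]]]
    by (simp add: mult.commute)
  show ?thesis
  proof (cases "b = d")
    case False
    then show ?thesis
      using partial_eq[OF has_derivative_const, of a 0 p] by (simp add: kt_metric_def)
  next
    case True
    have 1: "((\<lambda>u. - 1 / u\<^sup>2) has_real_derivative 2 / (kt_factor V c p)^3) (at (kt_factor V c p))"
      using assms(2) by (auto intro!: derivative_eq_intros simp: field_simps power_numeral_reduce)
    have 2: "((\<lambda>u. u\<^sup>2) has_real_derivative 2 * kt_factor V c p) (at (kt_factor V c p))"
      by (auto intro!: derivative_eq_intros)
    show ?thesis
      using True chain[OF 1] chain[OF 2] by (simp add: kt_metric_def split: option.split)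
  qed
qed

text \<open>The spatial rows determine the spatial acceleration; the evolution of \<open>T\<close>
  will come from nullity.\<close>

lemma matrix_inv_kt_metric:
  assumes "kt_factor V c p \<noteq> 0"
  shows "matrix_inv (kt_metric V c p) $ Some i $ e = (if e = Some i then 1 / (kt_factor V c p)\<^sup>2 else 0)"
proof -
  have "matrix_inv (kt_metric V c p) = (\<chi> a b. if a \<noteq> b then 0 else
      inverse (case a of None \<Rightarrow> - 1 / (kt_factor V c p)\<^sup>2 | Some i \<Rightarrow> (kt_factor V c p)\<^sup>2))"
    unfolding kt_metric_def
    by (rule matrix_inv_diagonal) (use assms in \<open>simp split: option.split\<close>)
  then show ?thesis
    by (auto simp: divide_inverse)
qed

text \<open>The metric is diagonal, so raising the index keeps only \<open>e = Some i\<close>, with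
  weight 1/U^2. The two positive terms come from derivatives of the entry U^2; the last
  differentiates the entry with index \<open>b\<close>, which gives 1/U^5 for time and 1/U for
  space.\<close>

lemma christoffel_kt_metric:
  assumes "V differentiable (at (space p))" and "kt_factor V c p \<noteq> 0"
  shows "christoffel (kt_metric V c) (Some i) b d p =
    (if d = Some i then kt_factor_deriv V c p (axis b 1) / kt_factor V c p else 0)
    + (if b = Some i then kt_factor_deriv V c p (axis d 1) / kt_factor V c p else 0)
    - (if b = d then partial i V (space p) *
        (case b of None \<Rightarrow> 1 / (kt_factor V c p)^5 | Some _ \<Rightarrow> 1 / kt_factor V c p) else 0)"
proof -
  have *: "(\<Sum>e\<in>UNIV. matrix_inv (kt_metric V c p) $ Some i $ e * F e) = F (Some i) / (kt_factor V c p)\<^sup>2" for F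
    using assms(2) by (simp add: matrix_inv_kt_metric if_distrib[of "\<lambda>x. x * _"] cong: if_cong)
  show ?thesis
    unfolding christoffel_def * partial_kt_metric[OF assms]
    by (cases b; cases d) (use assms(2) in \<open>auto simp: eval_nat_numeral\<close>)
qed

lemma christoffel_kt_metric_contract:
  assumes "V differentiable (at (space p))" and "kt_factor V c p \<noteq> 0"
  shows "(\<Sum>b\<in>UNIV. \<Sum>d\<in>UNIV. christoffel (kt_metric V c) (Some i) b d p * v $ b * v $ d) =
    2 * kt_factor_deriv V c p v * v $ Some i / kt_factor V c p
    - partial i V (space p) *
      ((v $ None)\<^sup>2 / (kt_factor V c p)^5 + (norm (space v))\<^sup>2 / kt_factor V c p)"
proof -
  \<comment> \<open>\<open>D\<close> holds the components of dU, and \<open>k\<close> the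
    coefficients of the gradient term, one for each diagonal index.\<close>
  define U D k where "U = kt_factor V c p" and "D = (\<lambda>a. kt_factor_deriv V c p (axis a 1))"
    and "k = (\<lambda>b::3 option. case b of None \<Rightarrow> 1 / U^5 | Some _ \<Rightarrow> 1 / U)"
  have "christoffel (kt_metric V c) (Some i) b d p * v $ b * v $ d =
      (if d = Some i then D b * v $ b * v $ d / U else 0)
      + (if b = Some i then D d * v $ d * v $ b / U else 0)
      - (if d = b then partial i V (space p) * k b * (v $ b)\<^sup>2 else 0)" for b d
    unfolding christoffel_kt_metric[OF assms] U_def D_def k_def
    by (auto simp: algebra_simps power2_eq_square simp del: kt_factor_deriv_axis_Some)
  \<comment> \<open>The two terms with dU exchange the roles of \<open>b\<close> and
    \<open>d\<close>, so they contract to the same value; hence the factor 2 below.\<close>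
  moreover have "(\<Sum>b\<in>UNIV. \<Sum>d\<in>UNIV. if b = Some i then D d * v $ d * v $ b / U else 0)
      = (\<Sum>b\<in>UNIV. D b * v $ b) * v $ Some i / U"
    by (subst sum.swap) (simp add: sum_distrib_right sum_divide_distrib)
  moreover have "(\<Sum>b\<in>UNIV. \<Sum>d\<in>UNIV. if d = Some i then D b * v $ b * v $ d / U else 0)
      = (\<Sum>b\<in>UNIV. D b * v $ b) * v $ Some i / U"
    by (simp add: sum_distrib_right sum_divide_distrib)
  moreover have "(\<Sum>b\<in>UNIV. \<Sum>d\<in>UNIV. if d = b then partial i V (space p) * k b * (v $ b)\<^sup>2 else 0)
      = partial i V (space p) * (\<Sum>b\<in>UNIV. k b * (v $ b)\<^sup>2)"
    by (simp add: sum_distrib_left mult.assoc)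
  ultimately have "(\<Sum>b\<in>UNIV. \<Sum>d\<in>UNIV. christoffel (kt_metric V c) (Some i) b d p * v $ b * v $ d) =
      2 * (\<Sum>b\<in>UNIV. D b * v $ b) * v $ Some i / U - partial i V (space p) * (\<Sum>b\<in>UNIV. k b * (v $ b)\<^sup>2)"
    by (simp only: sum.distrib sum_subtractf) 
  also have "(\<Sum>b\<in>UNIV. D b * v $ b) = kt_factor_deriv V c p v"
    unfolding D_def by (rule kt_factor_deriv_expand)
  also have "(\<Sum>b\<in>UNIV. k b * (v $ b)\<^sup>2) = (v $ None)\<^sup>2 / U^5 + (norm (space v))\<^sup>2 / U"
    by (simp add: sum_UNIV_option k_def norm_space sum_divide_distrib)
  finally show ?thesis
    by (simp add: U_def)
qed

section \<open>Null geodesics with affine parameter\<close>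

lemma null_vector_kt_metric:
  assumes "null_vector (kt_metric V c p) v" and "kt_factor V c p \<noteq> 0"
  shows "(v $ None)\<^sup>2 = (kt_factor V c p)^4 * (norm (space v))\<^sup>2"
proof -
  have "kt_metric V c p $ a $ b * v $ a * v $ b =
      (if b = a then kt_metric V c p $ a $ a * (v $ a)\<^sup>2 else 0)" for a b
    by (auto simp: kt_metric_def power2_eq_square)
  then have "0 = (\<Sum>a\<in>UNIV. kt_metric V c p $ a $ a * (v $ a)\<^sup>2)"
    using assms(1) by (simp add: null_vector_def)
  also have "\<dots> = - (v $ None)\<^sup>2 / (kt_factor V c p)\<^sup>2 + (kt_factor V c p)\<^sup>2 * (norm (space v))\<^sup>2"
    by (simp add: sum_UNIV_option kt_metric_def norm_space sum_distrib_left)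
  finally show ?thesis
    using assms(2) by (simp add: field_simps power_numeral_reduce)
qed

lemma kt_null_affine_geodesic_acceleration:
  assumes "affine_geodesic_on (kt_metric V c) (kt_domain \<Omega> V c) J \<sigma>" and "t \<in> J"
    and null: "null_vector (kt_metric V c (\<sigma> t)) (dot \<sigma> t)"
    and "\<forall>p\<in>\<Omega>. V differentiable (at p)"
  defines "p \<equiv> \<sigma> t" and "v \<equiv> dot \<sigma> t"
  shows "space (dot (dot \<sigma>) t) = (2 / kt_factor V c p) *\<^sub>R
    ((norm (space v))\<^sup>2 *\<^sub>R grad V (space p) - kt_factor_deriv V c p v *\<^sub>R space v)"
proof -
  have "p \<in> kt_domain \<Omega> V c"
    using assms by (simp add: affine_geodesic_on_def)
  then have V: "V differentiable (at (space p))" and U: "kt_factor V c p \<noteq> 0"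
    using assms(4) by (auto simp: kt_domain_def)
  have "space (dot (dot \<sigma>) t) $ i = (2 / kt_factor V c p) *
      ((norm (space v))\<^sup>2 * partial i V (space p) - kt_factor_deriv V c p v * v $ Some i)" for i
  proof -
    have "dot (dot \<sigma>) t $ Some i +
        (\<Sum>b\<in>UNIV. \<Sum>d\<in>UNIV. christoffel (kt_metric V c) (Some i) b d p * v $ b * v $ d) = 0"
      using assms(1,2) unfolding p_def v_def affine_geodesic_on_def by blast
    \<comment> \<open>Nullity makes the time part of the gradient term equal to its spatial part, so
      the two add up to twice the spatial one.\<close>
    moreover have "(v $ None)\<^sup>2 / kt_factor V c p ^ 5 = (norm (space v))\<^sup>2 / kt_factor V c p"
      using null_vector_kt_metric[of V c p v] null U
      by (simp add: p_def v_def) (simp add: eval_nat_numeral)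
    ultimately have "dot (dot \<sigma>) t $ Some i = partial i V (space p) *
        (2 * ((norm (space v))\<^sup>2 / kt_factor V c p))
        - 2 * kt_factor_deriv V c p v * v $ Some i / kt_factor V c p"
      by (simp add: christoffel_kt_metric_contract[OF V U])
    then show ?thesis
      by (simp add: algebra_simps diff_divide_distrib)
  qed
  then show ?thesis
    by (simp add: vec_eq_iff grad_def)
qed

section \<open>Change of parameter and arc length\<close>

lemma has_vector_derivative_dot:
  "f differentiable (at s) \<Longrightarrow> (f has_vector_derivative dot f s) (at s)"
  by (simp add: dot_def vector_derivative_works)

lemma dot_eq: "(f has_vector_derivative v) (at s) \<Longrightarrow> dot f s = v"
  by (simp add: dot_def vector_derivative_at)

text \<open>Chain and product rule. The summand with \<open>dot (dot \<phi>) s\<close> is the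
  multiple of the velocity by which a non-affine parameter changes the geodesic equation.\<close>

lemma dot_reparametrisation:
  assumes "open I" "twice_differentiable_on I \<phi>" "twice_differentiable_on J \<sigma>" "\<phi> ` I = J"
    and eq: "\<forall>r\<in>I. \<gamma> r = \<sigma> (\<phi> r)" and "s \<in> I"
  shows has_vector_derivative_reparametrisation:
      "(\<gamma> has_vector_derivative dot \<phi> s *\<^sub>R dot \<sigma> (\<phi> s)) (at s)" (is ?first)
    and has_vector_derivative_dot_reparametrisation:
      "(dot \<gamma> has_vector_derivative
        dot (dot \<phi>) s *\<^sub>R dot \<sigma> (\<phi> s) + (dot \<phi> s)\<^sup>2 *\<^sub>R dot (dot \<sigma>) (\<phi> s)) (at s)" (is ?second)
proof -
  \<comment> \<open>Needed on all of \<open>I\<close>: to differentiate \<open>dot \<gamma>\<close>,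
    it must agree with the formula near \<open>s\<close>.\<close>
  have first: "(\<gamma> has_vector_derivative dot \<phi> r *\<^sub>R dot \<sigma> (\<phi> r)) (at r)" if "r \<in> I" for r
  proof -
    have "((\<sigma> \<circ> \<phi>) has_vector_derivative dot \<phi> r *\<^sub>R dot \<sigma> (\<phi> r)) (at r)"
      using assms that
      by (intro vector_diff_chain_at has_vector_derivative_dot) (auto simp: twice_differentiable_on_def)
    then show ?thesis
      by (rule has_vector_derivative_transform_within_open[OF _ \<open>open I\<close> that]) (simp add: eq)
  qed
  show ?first
    using first \<open>s \<in> I\<close> .
  have d\<phi>: "(dot \<phi> has_real_derivative dot (dot \<phi>) s) (at s)"
    using assms has_vector_derivative_dot[of "dot \<phi>" s]
    by (simp add: twice_differentiable_on_def has_real_derivative_iff_has_vector_derivative)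
  have "((dot \<sigma> \<circ> \<phi>) has_vector_derivative dot \<phi> s *\<^sub>R dot (dot \<sigma>) (\<phi> s)) (at s)"
    using assms
    by (intro vector_diff_chain_at has_vector_derivative_dot) (auto simp: twice_differentiable_on_def)
  from has_vector_derivative_scaleR[OF d\<phi> this]
  have "((\<lambda>r. dot \<phi> r *\<^sub>R dot \<sigma> (\<phi> r)) has_vector_derivative
        dot (dot \<phi>) s *\<^sub>R dot \<sigma> (\<phi> s) + (dot \<phi> s)\<^sup>2 *\<^sub>R dot (dot \<sigma>) (\<phi> s)) (at s)"
    by (simp add: power2_eq_square add.commute)
  then show ?second
    by (rule has_vector_derivative_transform_within_open[OF _ \<open>open I\<close> \<open>s \<in> I\<close>])
      (simp add: dot_eq[OF first])
qed

text \<open>Arc length leaves a first-order equation for \<open>T\<close> and a second-order one for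
  \<open>x\<close>, both free of the reparametrisation. They hold at every point of the open set
  \<open>I\<close>, so they can be differentiated once more.\<close>

lemma kt_null_geodesic_arc_length_equations:
  assumes geo: "null_geodesic_on (kt_metric V c) (kt_domain \<Omega> V c) I (\<lambda>s. event (T s) (x s))"
    and "open I" and V: "\<forall>p\<in>\<Omega>. V differentiable (at p)"
    and unit: "\<forall>s\<in>I. norm (dot x s) = 1" and "\<forall>s\<in>I. dot T s > 0" and "s \<in> I"
  defines "U \<equiv> V (x s) + c * T s" and "N \<equiv> grad V (x s)"
  shows "x s \<in> \<Omega>" and "U \<noteq> 0"
    and "(x has_vector_derivative dot x s) (at s)"
    and "(T has_real_derivative U\<^sup>2) (at s)"
    and "(dot x has_vector_derivative (2 / U) *\<^sub>R (N - (dot x s \<bullet> N) *\<^sub>R dot x s)) (at s)"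
proof -
  define \<gamma> where "\<gamma> s = event (T s) (x s)" for s
  obtain J \<sigma> \<phi> where \<sigma>: "affine_geodesic_on (kt_metric V c) (kt_domain \<Omega> V c) J \<sigma>"
      "\<forall>t\<in>J. null_vector (kt_metric V c (\<sigma> t)) (dot \<sigma> t)"
    and \<phi>: "twice_differentiable_on I \<phi>" "\<forall>s\<in>I. dot \<phi> s \<noteq> 0" "\<phi> ` I = J"
    and \<gamma>: "\<forall>s\<in>I. \<gamma> s = \<sigma> (\<phi> s)"
    using geo unfolding null_geodesic_on_def \<gamma>_def by blast
  \<comment> \<open>Being images of \<open>\<gamma>\<close> under bounded linear maps,
    \<open>x\<close> and \<open>T\<close> inherit differentiability from \<open>\<sigma>\<close> and
    \<open>\<phi>\<close>.\<close>
  have x: "x = (\<lambda>r. space (\<gamma> r))" and T: "T = (\<lambda>r. \<gamma> r $ None)"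
    by (simp_all add: \<gamma>_def)
  have \<sigma>2: "twice_differentiable_on J \<sigma>"
    using \<sigma>(1) by (simp add: affine_geodesic_on_def)
  note d\<gamma> = has_vector_derivative_reparametrisation[OF \<open>open I\<close> \<phi>(1) \<sigma>2 \<phi>(3) \<gamma>]
  note d2\<gamma> = has_vector_derivative_dot_reparametrisation[OF \<open>open I\<close> \<phi>(1) \<sigma>2 \<phi>(3) \<gamma> \<open>s \<in> I\<close>]
  have dx: "(x has_vector_derivative space (dot \<gamma> r)) (at r)" if "r \<in> I" for r
    unfolding x using bounded_linear.has_vector_derivative[OF bounded_linear_space d\<gamma>[OF that]]
    by (simp add: dot_eq[OF d\<gamma>[OF that]])
  have dT: "(T has_vector_derivative dot \<gamma> s $ None) (at s)"
    unfolding T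
    using bounded_linear.has_vector_derivative[OF bounded_linear_vec_nth d\<gamma>[OF \<open>s \<in> I\<close>]]
    by (simp add: dot_eq[OF d\<gamma>[OF \<open>s \<in> I\<close>]])
  show "(x has_vector_derivative dot x s) (at s)"
    using dx[OF \<open>s \<in> I\<close>] dot_eq by fastforce

  define t v k where "t = \<phi> s" and "v = dot \<sigma> t" and "k = dot \<phi> s"
  have t: "t \<in> J" and k: "k \<noteq> 0"
    using \<phi> \<open>s \<in> I\<close> by (auto simp: t_def k_def)
  have \<sigma>t: "\<sigma> t = event (T s) (x s)"
    using \<gamma> \<open>s \<in> I\<close> by (simp add: t_def \<gamma>_def)
  have U: "kt_factor V c (\<sigma> t) = U"
    by (simp add: \<sigma>t kt_factor_def U_def)
  have "\<sigma> t \<in> kt_domain \<Omega> V c"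
    using \<sigma>(1) t by (simp add: affine_geodesic_on_def)
  then show "x s \<in> \<Omega>" "U \<noteq> 0"
    unfolding U[symmetric] by (simp_all add: kt_domain_def \<sigma>t)
  have x': "dot x s = k *\<^sub>R space v" and T': "dot T s = k * v $ None"
    using dot_eq[OF dx[OF \<open>s \<in> I\<close>]] dot_eq[OF dT] dot_eq[OF d\<gamma>[OF \<open>s \<in> I\<close>]]
    by (simp_all add: k_def v_def t_def space_linear)
  \<comment> \<open>Only the square of \<open>k\<close> is fixed, since \<open>\<phi>\<close> may
    reverse the direction.\<close>
  have kv: "k\<^sup>2 * (norm (space v))\<^sup>2 = 1"
  proof -
    have "(norm (k *\<^sub>R space v))\<^sup>2 = 1"
      using unit \<open>s \<in> I\<close> unfolding x'[symmetric] by simp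
    then show ?thesis
      by (simp add: power_mult_distrib)
  qed
  have "(dot T s)\<^sup>2 = k\<^sup>2 * (U^4 * (norm (space v))\<^sup>2)"
    using null_vector_kt_metric[of V c "\<sigma> t" v] \<sigma>(2) t \<open>U \<noteq> 0\<close>
    by (simp add: T' U power_mult_distrib v_def)
  also have "\<dots> = (U\<^sup>2)\<^sup>2"
    using kv by (simp add: algebra_simps)
  \<comment> \<open>Nullity leaves two signs for the root; \<open>dot T s > 0\<close> selects this
    one.\<close>
  finally have "dot T s = U\<^sup>2"
    by (rule power2_eq_imp_eq) (use assms(5) \<open>s \<in> I\<close> in \<open>auto intro: less_imp_le\<close>)
  then show "(T has_real_derivative U\<^sup>2) (at s)"
    using dT dot_eq[OF dT] by (simp add: has_real_derivative_iff_has_vector_derivative)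

  \<comment> \<open>\<open>\<alpha>\<close> gathers all multiples of the velocity: one from the
    change of parameter, one from the dU term. Its value is found below from orthogonality.\<close>
  define \<alpha> where "\<alpha> = dot (dot \<phi>) s / k - (2 / U) * (k * kt_factor_deriv V c (\<sigma> t) v)"
  have "((\<lambda>r. space (dot \<gamma> r)) has_vector_derivative
      space (dot (dot \<phi>) s *\<^sub>R v + k\<^sup>2 *\<^sub>R dot (dot \<sigma>) t)) (at s)"
    using bounded_linear.has_vector_derivative[OF bounded_linear_space d2\<gamma>]
    by (simp add: t_def v_def k_def)
  then have "(dot x has_vector_derivative
      space (dot (dot \<phi>) s *\<^sub>R v + k\<^sup>2 *\<^sub>R dot (dot \<sigma>) t)) (at s)"
    by (rule has_vector_derivative_transform_within_open[OF _ \<open>open I\<close> \<open>s \<in> I\<close>])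
      (simp add: dot_eq[OF dx])
  moreover have "space (dot (dot \<sigma>) t) = (2 / U) *\<^sub>R
      ((norm (space v))\<^sup>2 *\<^sub>R N - kt_factor_deriv V c (\<sigma> t) v *\<^sub>R space v)"
    using kt_null_affine_geodesic_acceleration[OF \<sigma>(1) t bspec[OF \<sigma>(2) t] V]
    unfolding U v_def N_def by (simp add: \<sigma>t)
  then have "space (dot (dot \<phi>) s *\<^sub>R v + k\<^sup>2 *\<^sub>R dot (dot \<sigma>) t)
      = dot (dot \<phi>) s *\<^sub>R space v + (2 / U) *\<^sub>R
        ((k\<^sup>2 * (norm (space v))\<^sup>2) *\<^sub>R N - (k\<^sup>2 * kt_factor_deriv V c (\<sigma> t) v) *\<^sub>R space v)"
    by (simp add: space_linear scaleR_diff_right mult.left_commute)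
  moreover have "\<dots> = \<alpha> *\<^sub>R dot x s + (2 / U) *\<^sub>R N"
    unfolding kv using k by (simp add: \<alpha>_def x' vec_eq_iff algebra_simps power2_eq_square)
  ultimately have d2x: "(dot x has_vector_derivative \<alpha> *\<^sub>R dot x s + (2 / U) *\<^sub>R N) (at s)"
    by simp

  \<comment> \<open>Differentiating the constant squared speed makes the acceleration orthogonal to
    the velocity, which determines \<open>\<alpha>\<close>.\<close>
  have xx: "dot x r \<bullet> dot x r = 1" if "r \<in> I" for r
    using unit that by (simp flip: power2_norm_eq_inner)
  have "((\<lambda>r. dot x r \<bullet> dot x r) has_vector_derivative
      dot x s \<bullet> (\<alpha> *\<^sub>R dot x s + (2 / U) *\<^sub>R N) + (\<alpha> *\<^sub>R dot x s + (2 / U) *\<^sub>R N) \<bullet> dot x s) (at s)"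
    by (rule bounded_bilinear.has_vector_derivative[OF bounded_bilinear_inner d2x d2x])
  moreover have "((\<lambda>r. dot x r \<bullet> dot x r) has_vector_derivative 0) (at s)"
    by (rule has_vector_derivative_transform_within_open[OF has_vector_derivative_const \<open>open I\<close> \<open>s \<in> I\<close>])
      (simp add: xx)
  ultimately have "dot x s \<bullet> (\<alpha> *\<^sub>R dot x s + (2 / U) *\<^sub>R N) = 0"
    using vector_derivative_unique_at by (fastforce simp: inner_commute)
  then have "\<alpha> = - (2 / U) * (dot x s \<bullet> N)"
    using xx[OF \<open>s \<in> I\<close>] by (simp add: inner_right_distrib)
  with d2x show "(dot x has_vector_derivative (2 / U) *\<^sub>R (N - (dot x s \<bullet> N) *\<^sub>R dot x s)) (at s)"
    by (simp add: algebra_simps)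
qed

section \<open>Differentiating the second-order equation\<close>

lemma has_vector_derivative_vec:
  fixes f :: "real \<Rightarrow> real^'n::finite"
  assumes "\<And>i. ((\<lambda>r. f r $ i) has_real_derivative f' $ i) (at s)"
  shows "(f has_vector_derivative f') (at s)"
proof -
  have expand: "(\<Sum>i\<in>UNIV. y $ i *\<^sub>R axis i 1) = y" for y :: "real^'n"
    by (simp add: basis_expansion flip: scalar_mult_eq_scaleR)
  have "((\<lambda>r. \<Sum>i\<in>UNIV. f r $ i *\<^sub>R axis i 1) has_vector_derivative
      (\<Sum>i\<in>UNIV. f' $ i *\<^sub>R axis i (1::real))) (at s)"
    using assms
    by (auto intro!: has_vector_derivative_sum derivative_eq_intros)
  then show ?thesis
    by (simp add: expand)
qed

text \<open>Quotient and product rule for the right-hand side of the equation for x''. In the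
  application \<open>N\<close> is grad V along the curve, and \<open>a\<close> stays symbolic so
  that its multiples can be collected.\<close>

lemma has_vector_derivative_projected_acceleration:
  fixes x' N :: "real \<Rightarrow> 'a::real_inner"
  assumes U: "(U has_real_derivative U') (at s)" "U s \<noteq> 0"
    and x': "(x' has_vector_derivative a) (at s)"
    and N: "(N has_vector_derivative H) (at s)"
  shows "((\<lambda>r. (2 / U r) *\<^sub>R (N r - (x' r \<bullet> N r) *\<^sub>R x' r)) has_vector_derivative
    (2 / U s) *\<^sub>R (H - (x' s \<bullet> H + a \<bullet> N s) *\<^sub>R x' s - (x' s \<bullet> N s) *\<^sub>R a)
    - (2 * U' / (U s)\<^sup>2) *\<^sub>R (N s - (x' s \<bullet> N s) *\<^sub>R x' s)) (at s)"
proof -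
  have 1: "((\<lambda>r. 2 / U r) has_real_derivative - (2 * U' / (U s)\<^sup>2)) (at s)"
    using U by (auto intro!: derivative_eq_intros simp: power2_eq_square)
  have "((\<lambda>r. x' r \<bullet> N r) has_vector_derivative x' s \<bullet> H + a \<bullet> N s) (at s)"
    by (rule bounded_bilinear.has_vector_derivative[OF bounded_bilinear_inner x' N])
  then have 2: "((\<lambda>r. x' r \<bullet> N r) has_real_derivative x' s \<bullet> H + a \<bullet> N s) (at s)"
    by (simp add: has_real_derivative_iff_has_vector_derivative)
  show ?thesis
    by (rule has_vector_derivative_eq_rhs[OF has_vector_derivative_scaleR[OF 1
          has_vector_derivative_diff[OF N has_vector_derivative_scaleR[OF 2 x']]]])
      (simp add: algebra_simps)
qed

text \<open>The existence of the third derivative is part of the conclusion: x'' equals an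
  expression in differentiable functions on all of \<open>I\<close>.\<close>

theorem mainTheorem2:
  fixes V :: "real^3 \<Rightarrow> real" and c :: real and \<Omega> :: "(real^3) set"
    and I :: "real set" and T :: "real \<Rightarrow> real" and x :: "real \<Rightarrow> real^3"
  assumes "harmonic_on \<Omega> V"
    and "open I" and "is_interval I"
    and "null_geodesic_on (kt_metric V c) (kt_domain \<Omega> V c) I (\<lambda>s. event (T s) (x s))"
    and "\<forall>s\<in>I. norm (dot x s) = 1"
    and "\<forall>s\<in>I. dot T s > 0"
  shows "\<forall>s\<in>I.
    (\<forall>i. ((\<lambda>r. dot (dot x) r $ i) has_real_derivative
        (- (norm (dot (dot x) s))\<^sup>2 * dot x s $ i
         - 3 * (dot (dot x) s \<bullet> grad V (x s))
             / (2 * ((norm (grad V (x s)))\<^sup>2 - (dot x s \<bullet> grad V (x s))\<^sup>2))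
             * (dot x s \<bullet> grad V (x s)) * dot (dot x) s $ i
         - 2 * c * (partial i V (x s) - (dot x s \<bullet> grad V (x s)) * dot x s $ i)
         + 2 / (V (x s) + c * T s)
             * ((\<Sum>m\<in>UNIV. partial i (partial m V) (x s) * dot x s $ m)
                - (\<Sum>k\<in>UNIV. \<Sum>l\<in>UNIV.
                     partial k (partial l V) (x s) * dot x s $ k * dot x s $ l * dot x s $ i))))
        (at s)) \<and>
    dot (dot x) s \<bullet> grad V (x s)
      = 2 / (V (x s) + c * T s)
          * ((norm (grad V (x s)))\<^sup>2 - (dot x s \<bullet> grad V (x s))\<^sup>2) \<and>
    ((norm (grad V (x s)))\<^sup>2 - (dot x s \<bullet> grad V (x s))\<^sup>2 \<noteq> 0 \<longrightarrow>
      (dot (dot x) has_vector_derivative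
        kt_projected_rhs V c (x s) (dot x s) (dot (dot x) s)) (at s))"
proof
  fix s assume "s \<in> I"
  have C2: "C2_on \<Omega> V" and "open \<Omega>"
    using assms(1) by (simp_all add: harmonic_on_def)
  have V: "\<forall>p\<in>\<Omega>. V differentiable (at p)" and dV: "\<forall>i. \<forall>p\<in>\<Omega>. partial i V differentiable (at p)"
    using C2 by (simp_all add: C2_on_def)
  note eqs = kt_null_geodesic_arc_length_equations[OF assms(4,2) V assms(5,6)]
  define y v a N U where "y = x s" and "v = dot x s" and "a = dot (dot x) s"
    and "N = grad V y" and "U = V y + c * T s"
  \<comment> \<open>\<open>H\<close> is the Hessian of \<open>V\<close> applied to the velocity. As
    \<open>v\<close> is a unit vector, \<open>W\<close> is the squared length of the part of
    \<open>N\<close> orthogonal to \<open>v\<close>.\<close>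
  define H where "H = (\<chi> i. \<Sum>m\<in>UNIV. partial i (partial m V) y * v $ m)"
  define W where "W = (norm N)\<^sup>2 - (v \<bullet> N)\<^sup>2"
  note folds = y_def[symmetric] v_def[symmetric] a_def[symmetric] N_def[symmetric] U_def[symmetric]
  have y: "y \<in> \<Omega>" and U: "U \<noteq> 0" and dx: "(x has_vector_derivative v) (at s)"
    and dT: "(T has_real_derivative U\<^sup>2) (at s)"
    and d2x: "(dot x has_vector_derivative a) (at s)" and a: "a = (2 / U) *\<^sub>R (N - (v \<bullet> N) *\<^sub>R v)"
    using eqs[OF \<open>s \<in> I\<close>] dot_eq[OF eqs(5)[OF \<open>s \<in> I\<close>]] unfolding folds by simp_all
  have v: "v \<bullet> v = 1"
    using assms(5) \<open>s \<in> I\<close> by (simp add: v_def flip: power2_norm_eq_inner)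

  \<comment> \<open>Pairing the equation for \<open>a\<close> with \<open>N\<close> gives the
    identity that eliminates 2/U.\<close>
  have aN: "a \<bullet> N = 2 / U * W"
    by (simp add: a W_def inner_diff_left power2_norm_eq_inner power2_eq_square[of "v \<bullet> N"])
  have "a \<bullet> a = (2 / U)\<^sup>2 * W"
    unfolding a W_def power2_norm_eq_inner
    by (simp add: inner_diff_left inner_diff_right v inner_commute[of N v] power2_eq_square algebra_simps)
  then have aa: "(norm a)\<^sup>2 = (2 / U)\<^sup>2 * W"
    by (simp add: power2_norm_eq_inner)
  \<comment> \<open>If \<open>W = 0\<close>, then \<open>a = 0\<close> by \<open>aa\<close>, so both
    sides vanish, with division by zero yielding 0. The stated formula thus holds at such points
    too.\<close>
  have second: "3 * (a \<bullet> N) / (2 * W) * (v \<bullet> N) * a $ i = 3 / U * (v \<bullet> N) * a $ i" for i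
  proof (cases "W = 0")
    case True
    then show ?thesis
      using aa by simp
  next
    case False
    then show ?thesis
      by (simp add: aN)
  qed

  have dN: "((\<lambda>r. grad V (x r)) has_vector_derivative H) (at s)"
  proof (rule has_vector_derivative_vec)
    fix i
    have "((\<lambda>r. partial i V (x r)) has_real_derivative grad (partial i V) y \<bullet> v) (at s)"
      unfolding y_def using dV y by (intro DERIV_along_curve dx) (simp add: y_def)
    \<comment> \<open>Symmetry of the Hessian enters here.\<close>
    also have "grad (partial i V) y \<bullet> v = H $ i"
      using C2_on_partial_commute[OF C2 \<open>open \<Omega>\<close> y, of _ i]
      by (simp add: inner_vec_def grad_def H_def)
    finally show "((\<lambda>r. grad V (x r) $ i) has_real_derivative H $ i) (at s)"
      by (simp add: grad_def)
  qed
  \<comment> \<open>Substituting T' = U^2 gives the part c U^2, the source of the term with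
    \<open>2 * c\<close>.\<close>
  have dU: "((\<lambda>r. V (x r) + c * T r) has_real_derivative (v \<bullet> N + c * U\<^sup>2)) (at s)"
    using DERIV_along_curve[OF dx, of V] V y dT
    by (auto intro!: derivative_eq_intros simp: y_def N_def inner_commute)
  define B where "B = (2 / U) *\<^sub>R (H - (v \<bullet> H + a \<bullet> N) *\<^sub>R v - (v \<bullet> N) *\<^sub>R a)
      - (2 * (v \<bullet> N + c * U\<^sup>2) / U\<^sup>2) *\<^sub>R (N - (v \<bullet> N) *\<^sub>R v)"
  have "((\<lambda>r. (2 / (V (x r) + c * T r)) *\<^sub>R (grad V (x r) - (dot x r \<bullet> grad V (x r)) *\<^sub>R dot x r))
      has_vector_derivative B) (at s)"
    using has_vector_derivative_projected_acceleration[OF dU _ d2x dN] U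
    unfolding folds B_def by simp
  then have d3x: "(dot (dot x) has_vector_derivative B) (at s)"
    by (rule has_vector_derivative_transform_within_open[OF _ \<open>open I\<close> \<open>s \<in> I\<close>])
      (simp add: dot_eq[OF eqs(5)])

  have vHv: "(\<Sum>k\<in>UNIV. \<Sum>l\<in>UNIV. partial k (partial l V) y * v $ k * v $ l * v $ i) = (v \<bullet> H) * v $ i" for i
    by (simp add: inner_vec_def H_def sum_distrib_left sum_distrib_right mult_ac)
  have B: "B $ i = - (norm a)\<^sup>2 * v $ i - 3 * (a \<bullet> N) / (2 * W) * (v \<bullet> N) * a $ i
      - 2 * c * (partial i V y - (v \<bullet> N) * v $ i)
      + 2 / U * ((\<Sum>m\<in>UNIV. partial i (partial m V) y * v $ m)
        - (\<Sum>k\<in>UNIV. \<Sum>l\<in>UNIV. partial k (partial l V) y * v $ k * v $ l * v $ i))" for i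
  proof -
    have ai: "a $ i = 2 / U * (N $ i - (v \<bullet> N) * v $ i)"
      by (simp add: a)
    \<comment> \<open>The quotient-rule term splits in two: its v . N part is (v . N)/U times
      \<open>a\<close>, and in its \<open>c\<close> part U^2 cancels.\<close>
    have "B $ i = 2 / U * (H $ i - (v \<bullet> H + 2 / U * W) * v $ i - (v \<bullet> N) * a $ i)
        - (v \<bullet> N) / U * a $ i - 2 * c * (N $ i - (v \<bullet> N) * v $ i)"
      using U by (simp add: B_def aN ai power2_eq_square) (simp add: field_simps)
    \<comment> \<open>The coefficient 3 is 2 from the product rule plus 1 from the quotient rule;
      (2/U)^2 W is recognised as |a|^2.\<close>
    also have "\<dots> = - (norm a)\<^sup>2 * v $ i - 3 / U * (v \<bullet> N) * a $ i
        - 2 * c * (N $ i - (v \<bullet> N) * v $ i) + 2 / U * (H $ i - (v \<bullet> H) * v $ i)"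
      unfolding aa using U by (simp add: power2_eq_square) (simp add: field_simps)
    finally show ?thesis
      unfolding second vHv by (simp add: H_def N_def grad_def)
  qed
  have comp: "((\<lambda>r. dot (dot x) r $ i) has_real_derivative B $ i) (at s)" for i
    using bounded_linear.has_vector_derivative[OF bounded_linear_vec_nth d3x]
    by (simp add: has_real_derivative_iff_has_vector_derivative)
  \<comment> \<open>Dividing \<open>aN\<close> by \<open>W\<close> recovers 2/U. Where
    \<open>W\<close> vanishes, so does \<open>a \<bullet> N\<close>, and the quotient no longer
    determines it.\<close>
  have proj: "kt_projected_rhs V c y v a = B" if "W \<noteq> 0"
  proof -
    have "(a \<bullet> N) / W = 2 / U"
      using that by (simp add: aN)
    then show ?thesis
      unfolding kt_projected_rhs_def Let_def folds W_def[symmetric] by (simp add: vec_eq_iff B)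
  qed
  show "(\<forall>i. ((\<lambda>r. dot (dot x) r $ i) has_real_derivative
        (- (norm (dot (dot x) s))\<^sup>2 * dot x s $ i
         - 3 * (dot (dot x) s \<bullet> grad V (x s))
             / (2 * ((norm (grad V (x s)))\<^sup>2 - (dot x s \<bullet> grad V (x s))\<^sup>2))
             * (dot x s \<bullet> grad V (x s)) * dot (dot x) s $ i
         - 2 * c * (partial i V (x s) - (dot x s \<bullet> grad V (x s)) * dot x s $ i)
         + 2 / (V (x s) + c * T s)
             * ((\<Sum>m\<in>UNIV. partial i (partial m V) (x s) * dot x s $ m)
                - (\<Sum>k\<in>UNIV. \<Sum>l\<in>UNIV.
                     partial k (partial l V) (x s) * dot x s $ k * dot x s $ l * dot x s $ i))))
        (at s)) \<and>
    dot (dot x) s \<bullet> grad V (x s)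
      = 2 / (V (x s) + c * T s)
          * ((norm (grad V (x s)))\<^sup>2 - (dot x s \<bullet> grad V (x s))\<^sup>2) \<and>
    ((norm (grad V (x s)))\<^sup>2 - (dot x s \<bullet> grad V (x s))\<^sup>2 \<noteq> 0 \<longrightarrow>
      (dot (dot x) has_vector_derivative
        kt_projected_rhs V c (x s) (dot x s) (dot (dot x) s)) (at s))"
    using comp proj d3x aN unfolding folds W_def[symmetric] B by metis
qed

end
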